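(* Let $\overline{(\cdot)}$ be the CGPS translation from $\lambda2\mathbf{J}^{\mathbf{mse}}$ into the domain-free second-order $\lambda$-calculus $\underline{\lambda}2$ described in the context. If $t\rightarrow u$ in $\lambda2\mathbf{J}^{\mathbf{mse}}$, then $\overline{t}\rightarrow^+_\beta\overline{u}$ in $\underline{\lambda}2$.
   Context: $\lambda2\mathbf{J}^{\mathbf{mse}}$: types $A,B::=X\mid A\supset B\mid\forall X.A$; terms $t,u::=x\mid\lambda x.t\mid\Lambda X.t\mid\{c\}$; co-terms $l::=[]\mid u::l\mid B::l\mid(x)c$ ($B$ a type); commands $c::=t\,l$. Evaluation contexts $E::=[]\mid u::l\mid B::l$. Writing $U$ for a term or a type: $[]@l'=l'$, $(U::l)@l'=U::(l@l')$, $((x)t\,l)@l'=(x)t(l@l')$. Reduction: closure under all constructors of $(\beta)\ (\lambda x.t)(u::l)\rightarrow u((x)t\,l)$; $(\beta2)\ (\Lambda X.t)(B::l)\rightarrow([B/X]t)\,l$; $(\pi)\ \{t\,l\}E\rightarrow t(l@E)$; $(\sigma)\ t(x)c\rightarrow[t/x]c$; $(\mu)\ (x)x\,l\rightarrow l$ if $x\notin l$; $(\epsilon)\ \{t[]\}\rightarrow t$ ($[B/X]$ is type substitution). $\underline{\lambda}2$: terms $x\mid\lambda x.t\mid tu\mid\Lambda X.t\mid tA$, with $\beta$-reduction meaning the compatible closure of $(\lambda x.t)u\rightarrow[u/x]t$ and $(\Lambda X.t)B\rightarrow[B/X]t$. Translation: $\bot$ fixed type variable, $\neg A=A\supset\bot$;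 $\mathsf{s}$ a fixed closed term with $\mathsf{s}\,G\rightarrow^+_\beta G$ (e.g. $\lambda z.z$), $G^+=\mathsf{s}\,G$; $[t;u]=(\lambda y.t)u$ with $y\notin t$. Types: $\overline{A}=\top\supset\neg\neg A^*$, $X^*=X$, $(A\supset B)^*=\neg\overline{B}\supset\neg\overline{A}$, $(\forall X.A)^*=\forall X.\overline{A}$. Expressions ($w,m$ fresh): $(x:G,K)=x\,G^+K$; $(\lambda x.t:G,K)=[K(\lambda wx.w\,\overline{t});G]$; $(\Lambda X.t:G,K)=[K(\Lambda X.\overline{t});G]$; $(\{c\}:G,K)=(c:G^+,K)$; $([]:G,K)=\lambda w.wGK$; $(u::l:G,K)=\lambda w.wG(\lambda m.m\,(l:G,K)\,\overline{u})$; $(B::l:G,K)=\lambda w.wG(\lambda m.(l:G,K)(mB^* ))$; $((x)c:G,K)=\lambda x.(c:G,K)$; $(t[]:G,K)=(t:G,K)$; $(t(u::l):G,K)=(t:G,\lambda m.m\,(l:G,K)\,\overline{u})$; $(t(B::l):G,K)=(t:G,\lambda m.(l:G,K)(mB^* ))$; $(t(x)c:G,K)=((x)c:G,K)\,\overline{t}$; $\overline{t}=\lambda gk.(t:g,k)$ with $g,k$ fresh. *)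

theory Defs
  imports Main
begin

text \<open>
  Both calculi are represented up to renaming of bound variables, with de Bruijn indices; term
  variables and type variables are indexed separately, so that crossing a term binder does not
  affect the indices of type variables, and vice versa.
\<close>

section \<open>Types\<close>

datatype ty = TVar nat | Imp ty ty (infixr "\<rightharpoondown>" 60) | All ty

primrec lift_ty :: "nat \<Rightarrow> ty \<Rightarrow> ty" where
  "lift_ty k (TVar i) = TVar (if i < k then i else Suc i)"
| "lift_ty k (A \<rightharpoondown> B) = lift_ty k A \<rightharpoondown> lift_ty k B"
| "lift_ty k (All A) = All (lift_ty (Suc k) A)"

text \<open>Here and below, substitution for the variable \<open>k\<close> also removes \<open>k\<close> from the context: the
  larger indices are decremented, as needed for contracting a redex.\<close>

primrec subst_ty :: "nat \<Rightarrow> ty \<Rightarrow> ty \<Rightarrow> ty" where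
  "subst_ty k B (TVar i) = (if i < k then TVar i else if i = k then B else TVar (i - 1))"
| "subst_ty k B (A \<rightharpoondown> A') = subst_ty k B A \<rightharpoondown> subst_ty k B A'"
| "subst_ty k B (All A) = All (subst_ty (Suc k) (lift_ty 0 B) A)"


section \<open>The source calculus\<close>

text \<open>\<open>Coerce c\<close> is $\{c\}$, \<open>u \<Colon> l\<close> and \<open>B \<Colon>\<^sub>T l\<close> are the two forms of $U::l$, \<open>Sel c\<close> is $(x)c$ (which
  binds a term variable in \<open>c\<close>), and \<open>t \<bullet> l\<close> is the command $t\,l$.\<close>

datatype tm = Var nat | Lam tm | TLam tm | Coerce cmd
  and coterm =
    Empty
  | Arg tm coterm (infixr "\<Colon>" 65)
  | TArg ty coterm (infixr "\<Colon>\<^sub>T" 65)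
  | Sel cmd
  and cmd = Cmd tm coterm (infix "\<bullet>" 60)

primrec lift_tm :: "nat \<Rightarrow> tm \<Rightarrow> tm"
  and lift_co :: "nat \<Rightarrow> coterm \<Rightarrow> coterm"
  and lift_cmd :: "nat \<Rightarrow> cmd \<Rightarrow> cmd"
where
  "lift_tm k (Var i) = Var (if i < k then i else Suc i)"
| "lift_tm k (Lam t) = Lam (lift_tm (Suc k) t)"
| "lift_tm k (TLam t) = TLam (lift_tm k t)"
| "lift_tm k (Coerce c) = Coerce (lift_cmd k c)"
| "lift_co k Empty = Empty"
| "lift_co k (u \<Colon> l) = lift_tm k u \<Colon> lift_co k l"
| "lift_co k (B \<Colon>\<^sub>T l) = B \<Colon>\<^sub>T lift_co k l"
| "lift_co k (Sel c) = Sel (lift_cmd (Suc k) c)"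
| "lift_cmd k (t \<bullet> l) = lift_tm k t \<bullet> lift_co k l"

primrec tylift_tm :: "nat \<Rightarrow> tm \<Rightarrow> tm"
  and tylift_co :: "nat \<Rightarrow> coterm \<Rightarrow> coterm"
  and tylift_cmd :: "nat \<Rightarrow> cmd \<Rightarrow> cmd"
where
  "tylift_tm k (Var i) = Var i"
| "tylift_tm k (Lam t) = Lam (tylift_tm k t)"
| "tylift_tm k (TLam t) = TLam (tylift_tm (Suc k) t)"
| "tylift_tm k (Coerce c) = Coerce (tylift_cmd k c)"
| "tylift_co k Empty = Empty"
| "tylift_co k (u \<Colon> l) = tylift_tm k u \<Colon> tylift_co k l"
| "tylift_co k (B \<Colon>\<^sub>T l) = lift_ty k B \<Colon>\<^sub>T tylift_co k l"
| "tylift_co k (Sel c) = Sel (tylift_cmd k c)"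
| "tylift_cmd k (t \<bullet> l) = tylift_tm k t \<bullet> tylift_co k l"

primrec subst_tm :: "nat \<Rightarrow> tm \<Rightarrow> tm \<Rightarrow> tm"
  and subst_co :: "nat \<Rightarrow> tm \<Rightarrow> coterm \<Rightarrow> coterm"
  and subst_cmd :: "nat \<Rightarrow> tm \<Rightarrow> cmd \<Rightarrow> cmd"
where
  "subst_tm k v (Var i) = (if i < k then Var i else if i = k then v else Var (i - 1))"
| "subst_tm k v (Lam t) = Lam (subst_tm (Suc k) (lift_tm 0 v) t)"
| "subst_tm k v (TLam t) = TLam (subst_tm k (tylift_tm 0 v) t)"
| "subst_tm k v (Coerce c) = Coerce (subst_cmd k v c)"
| "subst_co k v Empty = Empty"
| "subst_co k v (u \<Colon> l) = subst_tm k v u \<Colon> subst_co k v l"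
| "subst_co k v (B \<Colon>\<^sub>T l) = B \<Colon>\<^sub>T subst_co k v l"
| "subst_co k v (Sel c) = Sel (subst_cmd (Suc k) (lift_tm 0 v) c)"
| "subst_cmd k v (t \<bullet> l) = subst_tm k v t \<bullet> subst_co k v l"

primrec tysubst_tm :: "nat \<Rightarrow> ty \<Rightarrow> tm \<Rightarrow> tm"
  and tysubst_co :: "nat \<Rightarrow> ty \<Rightarrow> coterm \<Rightarrow> coterm"
  and tysubst_cmd :: "nat \<Rightarrow> ty \<Rightarrow> cmd \<Rightarrow> cmd"
where
  "tysubst_tm k B (Var i) = Var i"
| "tysubst_tm k B (Lam t) = Lam (tysubst_tm k B t)"
| "tysubst_tm k B (TLam t) = TLam (tysubst_tm (Suc k) (lift_ty 0 B) t)"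
| "tysubst_tm k B (Coerce c) = Coerce (tysubst_cmd k B c)"
| "tysubst_co k B Empty = Empty"
| "tysubst_co k B (u \<Colon> l) = tysubst_tm k B u \<Colon> tysubst_co k B l"
| "tysubst_co k B (A \<Colon>\<^sub>T l) = subst_ty k B A \<Colon>\<^sub>T tysubst_co k B l"
| "tysubst_co k B (Sel c) = Sel (tysubst_cmd k B c)"
| "tysubst_cmd k B (t \<bullet> l) = tysubst_tm k B t \<bullet> tysubst_co k B l"

fun append_co :: "coterm \<Rightarrow> coterm \<Rightarrow> coterm" (infixr "@@" 65) where
  "Empty @@ l' = l'"
| "(u \<Colon> l) @@ l' = u \<Colon> (l @@ l')"
| "(B \<Colon>\<^sub>T l) @@ l' = B \<Colon>\<^sub>T (l @@ l')"
| "Sel (t \<bullet> l) @@ l' = Sel (t \<bullet> (l @@ lift_co 0 l'))"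

text \<open>Evaluation contexts are the co-terms not of the form $(x)c$.\<close>

fun is_ectx :: "coterm \<Rightarrow> bool" where
  "is_ectx Empty = True"
| "is_ectx (u \<Colon> l) = True"
| "is_ectx (B \<Colon>\<^sub>T l) = True"
| "is_ectx (Sel c) = False"

text \<open>In \<open>beta\<close>, the co-term \<open>l\<close> moves under a binder and is lifted. In \<open>mu\<close>, the side condition that
  \<open>x\<close> is not free in the co-term says that the co-term is of the form \<open>lift_co 0 l\<close>, and \<open>l\<close> is this
  same co-term read outside the scope of \<open>x\<close>.\<close>

inductive red_tm :: "tm \<Rightarrow> tm \<Rightarrow> bool" (infix "\<rightarrow>\<^sub>t" 50)
  and red_co :: "coterm \<Rightarrow> coterm \<Rightarrow> bool" (infix "\<rightarrow>\<^sub>l" 50)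
  and red_cmd :: "cmd \<Rightarrow> cmd \<Rightarrow> bool" (infix "\<rightarrow>\<^sub>c" 50)
where
  beta: "Lam t \<bullet> (u \<Colon> l) \<rightarrow>\<^sub>c u \<bullet> Sel (t \<bullet> lift_co 0 l)"
| beta2: "TLam t \<bullet> (B \<Colon>\<^sub>T l) \<rightarrow>\<^sub>c tysubst_tm 0 B t \<bullet> l"
| pi: "is_ectx E \<Longrightarrow> Coerce (t \<bullet> l) \<bullet> E \<rightarrow>\<^sub>c t \<bullet> (l @@ E)"
| sigma: "t \<bullet> Sel c \<rightarrow>\<^sub>c subst_cmd 0 t c"
| mu: "Sel (Var 0 \<bullet> lift_co 0 l) \<rightarrow>\<^sub>l l"
| epsilon: "Coerce (t \<bullet> Empty) \<rightarrow>\<^sub>t t"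
| red_Lam: "t \<rightarrow>\<^sub>t t' \<Longrightarrow> Lam t \<rightarrow>\<^sub>t Lam t'"
| red_TLam: "t \<rightarrow>\<^sub>t t' \<Longrightarrow> TLam t \<rightarrow>\<^sub>t TLam t'"
| red_Coerce: "c \<rightarrow>\<^sub>c c' \<Longrightarrow> Coerce c \<rightarrow>\<^sub>t Coerce c'"
| red_Arg1: "u \<rightarrow>\<^sub>t u' \<Longrightarrow> u \<Colon> l \<rightarrow>\<^sub>l u' \<Colon> l"
| red_Arg2: "l \<rightarrow>\<^sub>l l' \<Longrightarrow> u \<Colon> l \<rightarrow>\<^sub>l u \<Colon> l'"
| red_TArg: "l \<rightarrow>\<^sub>l l' \<Longrightarrow> B \<Colon>\<^sub>T l \<rightarrow>\<^sub>l B \<Colon>\<^sub>T l'"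
| red_Sel: "c \<rightarrow>\<^sub>c c' \<Longrightarrow> Sel c \<rightarrow>\<^sub>l Sel c'"
| red_Cmd1: "t \<rightarrow>\<^sub>t t' \<Longrightarrow> t \<bullet> l \<rightarrow>\<^sub>c t' \<bullet> l"
| red_Cmd2: "l \<rightarrow>\<^sub>l l' \<Longrightarrow> t \<bullet> l \<rightarrow>\<^sub>c t \<bullet> l'"


section \<open>The domain-free second-order lambda-calculus\<close>

datatype lam = V nat | Abs lam | App lam lam (infixl "\<cdot>" 70) | TAbs lam | TApp lam ty (infixl "\<cdot>\<^sub>T" 70)

primrec lift :: "nat \<Rightarrow> lam \<Rightarrow> lam" where
  "lift k (V i) = V (if i < k then i else Suc i)"
| "lift k (Abs t) = Abs (lift (Suc k) t)"
| "lift k (t \<cdot> u) = lift k t \<cdot> lift k u"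
| "lift k (TAbs t) = TAbs (lift k t)"
| "lift k (t \<cdot>\<^sub>T A) = lift k t \<cdot>\<^sub>T A"

primrec tylift :: "nat \<Rightarrow> lam \<Rightarrow> lam" where
  "tylift k (V i) = V i"
| "tylift k (Abs t) = Abs (tylift k t)"
| "tylift k (t \<cdot> u) = tylift k t \<cdot> tylift k u"
| "tylift k (TAbs t) = TAbs (tylift (Suc k) t)"
| "tylift k (t \<cdot>\<^sub>T A) = tylift k t \<cdot>\<^sub>T lift_ty k A"

primrec subst :: "nat \<Rightarrow> lam \<Rightarrow> lam \<Rightarrow> lam" where
  "subst k v (V i) = (if i < k then V i else if i = k then v else V (i - 1))"
| "subst k v (Abs t) = Abs (subst (Suc k) (lift 0 v) t)"
| "subst k v (t \<cdot> u) = subst k v t \<cdot> subst k v u"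
| "subst k v (TAbs t) = TAbs (subst k (tylift 0 v) t)"
| "subst k v (t \<cdot>\<^sub>T A) = subst k v t \<cdot>\<^sub>T A"

primrec tysubst :: "nat \<Rightarrow> ty \<Rightarrow> lam \<Rightarrow> lam" where
  "tysubst k B (V i) = V i"
| "tysubst k B (Abs t) = Abs (tysubst k B t)"
| "tysubst k B (t \<cdot> u) = tysubst k B t \<cdot> tysubst k B u"
| "tysubst k B (TAbs t) = TAbs (tysubst (Suc k) (lift_ty 0 B) t)"
| "tysubst k B (t \<cdot>\<^sub>T A) = tysubst k B t \<cdot>\<^sub>T subst_ty k B A"

inductive beta_red :: "lam \<Rightarrow> lam \<Rightarrow> bool" (infix "\<rightarrow>\<^sub>\<beta>" 50) where
  beta_tm: "Abs t \<cdot> u \<rightarrow>\<^sub>\<beta> subst 0 u t"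
| beta_ty: "TAbs t \<cdot>\<^sub>T B \<rightarrow>\<^sub>\<beta> tysubst 0 B t"
| beta_Abs: "t \<rightarrow>\<^sub>\<beta> t' \<Longrightarrow> Abs t \<rightarrow>\<^sub>\<beta> Abs t'"
| beta_App1: "t \<rightarrow>\<^sub>\<beta> t' \<Longrightarrow> t \<cdot> u \<rightarrow>\<^sub>\<beta> t' \<cdot> u"
| beta_App2: "u \<rightarrow>\<^sub>\<beta> u' \<Longrightarrow> t \<cdot> u \<rightarrow>\<^sub>\<beta> t \<cdot> u'"
| beta_TAbs: "t \<rightarrow>\<^sub>\<beta> t' \<Longrightarrow> TAbs t \<rightarrow>\<^sub>\<beta> TAbs t'"
| beta_TApp: "t \<rightarrow>\<^sub>\<beta> t' \<Longrightarrow> t \<cdot>\<^sub>T A \<rightarrow>\<^sub>\<beta> t' \<cdot>\<^sub>T A"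

abbreviation beta_plus :: "lam \<Rightarrow> lam \<Rightarrow> bool" (infix "\<rightarrow>\<^sub>\<beta>\<^sup>+" 50) where
  "t \<rightarrow>\<^sub>\<beta>\<^sup>+ u \<equiv> beta_red\<^sup>+\<^sup>+ t u"

text \<open>The free variables of a type or term lie below the given bounds (\<open>m\<close> for type variables, \<open>n\<close>
  for term variables); a term is closed if it has neither free term variables nor free type
  variables.\<close>

primrec ty_below :: "nat \<Rightarrow> ty \<Rightarrow> bool" where
  "ty_below m (TVar i) = (i < m)"
| "ty_below m (A \<rightharpoondown> B) = (ty_below m A \<and> ty_below m B)"
| "ty_below m (All A) = ty_below (Suc m) A"

primrec below :: "nat \<Rightarrow> nat \<Rightarrow> lam \<Rightarrow> bool" where
  "below m n (V i) = (i < n)"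
| "below m n (Abs t) = below m (Suc n) t"
| "below m n (t \<cdot> u) = (below m n t \<and> below m n u)"
| "below m n (TAbs t) = below (Suc m) n t"
| "below m n (t \<cdot>\<^sub>T A) = (below m n t \<and> ty_below m A)"

definition closed :: "lam \<Rightarrow> bool" where
  "closed t \<longleftrightarrow> below 0 0 t"


section \<open>The CGPS translation\<close>

text \<open>The fixed type variable \<open>\<bottom>\<close> is given by its index \<open>b\<close>, the type \<open>\<top>\<close> is an arbitrary fixed type
  \<open>T\<close>. Under a type binder, the same variable and the same type are denoted by \<open>Suc b\<close> and
  \<open>lift_ty 0 T\<close>.\<close>

definition neg :: "nat \<Rightarrow> ty \<Rightarrow> ty" where
  "neg b A = A \<rightharpoondown> TVar b"

fun bar_ty :: "nat \<Rightarrow> ty \<Rightarrow> ty \<Rightarrow> ty"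
  and star_ty :: "nat \<Rightarrow> ty \<Rightarrow> ty \<Rightarrow> ty"
where
  "bar_ty b T A = T \<rightharpoondown> neg b (neg b (star_ty b T A))"
| "star_ty b T (TVar X) = TVar X"
| "star_ty b T (A \<rightharpoondown> B) = neg b (bar_ty b T B) \<rightharpoondown> neg b (bar_ty b T A)"
| "star_ty b T (All A) = All (bar_ty (Suc b) (lift_ty 0 T) A)"

text \<open>The term $[t;u] = (\lambda y.t)u$ with \<open>y\<close> not free in \<open>t\<close>.\<close>

definition discard :: "lam \<Rightarrow> lam \<Rightarrow> lam" where
  "discard t u = Abs (lift 0 t) \<cdot> u"

text \<open>The continuations $\lambda m.\,m\,L\,U$ and $\lambda m.\,L(m\,A)$.\<close>

definition cont_arg :: "lam \<Rightarrow> lam \<Rightarrow> lam" where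
  "cont_arg L U = Abs (V 0 \<cdot> lift 0 L \<cdot> lift 0 U)"

definition cont_tyarg :: "lam \<Rightarrow> ty \<Rightarrow> lam" where
  "cont_tyarg L A = Abs (lift 0 L \<cdot> (V 0 \<cdot>\<^sub>T A))"

lemma size_lift [simp]:
  "size (lift_tm k t) = size t"
  "size (lift_co k l) = size l"
  "size (lift_cmd k c) = size c"
  by (induction t and l and c arbitrary: k and k and k) auto

text \<open>\<open>tr_tm b T s t G K\<close> is $(t:G,K)$, and similarly for co-terms and commands; the source
  expression, \<open>G\<close> and \<open>K\<close> all live in the same context of term variables. For \<open>Lam t\<close>, the body
  \<open>t\<close> has \<open>x\<close> as variable \<open>0\<close>, and \<open>lift 1\<close> makes room for \<open>w\<close>, which is bound outside of \<open>x\<close>. The closed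
  term \<open>s\<close> needs no lifting.\<close>

function (sequential)
      tr_tm :: "nat \<Rightarrow> ty \<Rightarrow> lam \<Rightarrow> tm \<Rightarrow> lam \<Rightarrow> lam \<Rightarrow> lam"
  and tr_co :: "nat \<Rightarrow> ty \<Rightarrow> lam \<Rightarrow> coterm \<Rightarrow> lam \<Rightarrow> lam \<Rightarrow> lam"
  and tr_cmd :: "nat \<Rightarrow> ty \<Rightarrow> lam \<Rightarrow> cmd \<Rightarrow> lam \<Rightarrow> lam \<Rightarrow> lam"
  and bar_tm :: "nat \<Rightarrow> ty \<Rightarrow> lam \<Rightarrow> tm \<Rightarrow> lam"
where
  "tr_tm b T s (Var x) G K = V x \<cdot> (s \<cdot> G) \<cdot> K"
| "tr_tm b T s (Lam t) G K = discard (K \<cdot> Abs (Abs (V 1 \<cdot> lift 1 (bar_tm b T s t)))) G"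
| "tr_tm b T s (TLam t) G K = discard (K \<cdot> TAbs (bar_tm (Suc b) (lift_ty 0 T) s t)) G"
| "tr_tm b T s (Coerce c) G K = tr_cmd b T s c (s \<cdot> G) K"
| "tr_co b T s Empty G K = Abs (V 0 \<cdot> lift 0 G \<cdot> lift 0 K)"
| "tr_co b T s (u \<Colon> l) G K =
     Abs (V 0 \<cdot> lift 0 G \<cdot> lift 0 (cont_arg (tr_co b T s l G K) (bar_tm b T s u)))"
| "tr_co b T s (B \<Colon>\<^sub>T l) G K =
     Abs (V 0 \<cdot> lift 0 G \<cdot> lift 0 (cont_tyarg (tr_co b T s l G K) (star_ty b T B)))"
| "tr_co b T s (Sel c) G K = Abs (tr_cmd b T s c (lift 0 G) (lift 0 K))"
| "tr_cmd b T s (t \<bullet> Empty) G K = tr_tm b T s t G K"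
| "tr_cmd b T s (t \<bullet> (u \<Colon> l)) G K =
     tr_tm b T s t G (cont_arg (tr_co b T s l G K) (bar_tm b T s u))"
| "tr_cmd b T s (t \<bullet> (B \<Colon>\<^sub>T l)) G K =
     tr_tm b T s t G (cont_tyarg (tr_co b T s l G K) (star_ty b T B))"
| "tr_cmd b T s (t \<bullet> Sel c) G K = tr_co b T s (Sel c) G K \<cdot> bar_tm b T s t"
| "bar_tm b T s t = Abs (Abs (tr_tm b T s (lift_tm 0 (lift_tm 0 t)) (V 1) (V 0)))"
  by pat_completeness auto
termination
  by (relation "measure (\<lambda>x. case x of
        Inl (Inl (b, T, s, t, G, K)) \<Rightarrow> 2 * size t
      | Inl (Inr (b, T, s, l, G, K)) \<Rightarrow> 2 * size l
      | Inr (Inl (b, T, s, c, G, K)) \<Rightarrow> 2 * size c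
      | Inr (Inr (b, T, s, t)) \<Rightarrow> 2 * size t + 1)") auto

end

theory Submission
  imports Defs
begin

text \<open>
  No clause of the translation erases $G$ or $K$, so $(t:G,K)$ is strictly monotone in both, and the
  garbage $s G$ created at every $\{c\}$ and every variable provides the reduction steps that make
  \<open>\<pi>\<close>, \<open>\<epsilon>\<close> and \<open>\<mu>\<close> strict: up to this garbage, the two sides of \<open>\<pi>\<close> and \<open>\<epsilon>\<close> have equal translations.
  Since $\overline{v} G K$ reduces to $(v:G,K)$, substituting $\overline{v}$ for $x$ in the translation of
  $t$ yields a term that reduces to the translation of $[v/x]t$, which gives \<open>\<sigma>\<close>; and \<open>\<beta>\<close> and \<open>\<beta>2\<close>
  follow because $(l:G,K) \overline{t}$ reduces to $(t l:G,K)$.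
\<close>

section \<open>Commutation of lifting and substitution\<close>

lemma lift_lift_ty: "i \<le> k \<Longrightarrow> lift_ty i (lift_ty k A) = lift_ty (Suc k) (lift_ty i A)"
  by (induction A arbitrary: i k) auto

lemma subst_lift_ty [simp]: "subst_ty k B (lift_ty k A) = A"
  by (induction A arbitrary: k B) auto

lemma lift_lift:
  "i \<le> k \<Longrightarrow> lift_tm i (lift_tm k t) = lift_tm (Suc k) (lift_tm i t)"
  "i \<le> k \<Longrightarrow> lift_co i (lift_co k l) = lift_co (Suc k) (lift_co i l)"
  "i \<le> k \<Longrightarrow> lift_cmd i (lift_cmd k c) = lift_cmd (Suc k) (lift_cmd i c)"
  by (induction t and l and c arbitrary: i k and i k and i k) auto

lemma lift_tylift:
  "lift_tm i (tylift_tm k t) = tylift_tm k (lift_tm i t)"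
  "lift_co i (tylift_co k l) = tylift_co k (lift_co i l)"
  "lift_cmd i (tylift_cmd k c) = tylift_cmd k (lift_cmd i c)"
  by (induction t and l and c arbitrary: i k and i k and i k) auto

lemma lift_tysubst:
  "lift_tm i (tysubst_tm k B t) = tysubst_tm k B (lift_tm i t)"
  "lift_co i (tysubst_co k B l) = tysubst_co k B (lift_co i l)"
  "lift_cmd i (tysubst_cmd k B c) = tysubst_cmd k B (lift_cmd i c)"
  by (induction t and l and c arbitrary: i k B and i k B and i k B) auto

lemma lift_subst_above:
  "k \<le> i \<Longrightarrow> lift_tm i (subst_tm k v t) = subst_tm k (lift_tm i v) (lift_tm (Suc i) t)"
  "k \<le> i \<Longrightarrow> lift_co i (subst_co k v l) = subst_co k (lift_tm i v) (lift_co (Suc i) l)"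
  "k \<le> i \<Longrightarrow> lift_cmd i (subst_cmd k v c) = subst_cmd k (lift_tm i v) (lift_cmd (Suc i) c)"
  by (induction t and l and c arbitrary: i k v and i k v and i k v)
    (auto simp: lift_lift lift_tylift)

lemma lift_subst_below:
  "i \<le> k \<Longrightarrow> lift_tm i (subst_tm k v t) = subst_tm (Suc k) (lift_tm i v) (lift_tm i t)"
  "i \<le> k \<Longrightarrow> lift_co i (subst_co k v l) = subst_co (Suc k) (lift_tm i v) (lift_co i l)"
  "i \<le> k \<Longrightarrow> lift_cmd i (subst_cmd k v c) = subst_cmd (Suc k) (lift_tm i v) (lift_cmd i c)"
  by (induction t and l and c arbitrary: i k v and i k v and i k v)
    (auto simp: lift_lift lift_tylift)

lemma subst_lift [simp]:
  "subst_tm k v (lift_tm k t) = t"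
  "subst_co k v (lift_co k l) = l"
  "subst_cmd k v (lift_cmd k c) = c"
  by (induction t and l and c arbitrary: k v and k v and k v) auto

text \<open>After lifting at \<open>Suc k\<close> that index does not occur, so replacing
  \<open>k\<close> by itself and closing the gap undoes the lifting. This is the renaming behind a
  \<mu>-redex whose co-term is itself of the form \<open>Sel c\<close>.\<close>

lemma subst_Var_lift:
  "subst_tm k (Var k) (lift_tm (Suc k) t) = t"
  "subst_co k (Var k) (lift_co (Suc k) l) = l"
  "subst_cmd k (Var k) (lift_cmd (Suc k) c) = c"
  by (induction t and l and c arbitrary: k and k and k) auto

lemma lift_append: "lift_co k (l @@ l') = lift_co k l @@ lift_co k l'"
  by (induction l l' arbitrary: k rule: append_co.induct) (auto simp: lift_lift)

lemma append_Empty [simp]: "l @@ Empty = l"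
  by (induction l Empty rule: append_co.induct) auto

lemma is_ectx_lift [simp]: "is_ectx (lift_co k l) = is_ectx l"
  by (cases l) auto

section \<open>Commutation laws in the target calculus\<close>

lemma lift_lift_lam: "i \<le> k \<Longrightarrow> lift i (lift k t) = lift (Suc k) (lift i t)"
  by (induction t arbitrary: i k) auto

lemma lift_tylift_lam: "lift i (tylift k t) = tylift k (lift i t)"
  by (induction t arbitrary: i k) auto

lemma lift_tysubst_lam: "lift i (tysubst k B t) = tysubst k B (lift i t)"
  by (induction t arbitrary: i k B) auto

lemma lift_subst_lam_above:
  "k \<le> i \<Longrightarrow> lift i (subst k v t) = subst k (lift i v) (lift (Suc i) t)"
  by (induction t arbitrary: i k v) (auto simp: lift_lift_lam lift_tylift_lam)

lemma lift_subst_lam_below: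
  "i \<le> k \<Longrightarrow> lift i (subst k v t) = subst (Suc k) (lift i v) (lift i t)"
  by (induction t arbitrary: i k v) (auto simp: lift_lift_lam lift_tylift_lam)

lemma subst_lift_lam [simp]: "subst k v (lift k t) = t"
  by (induction t arbitrary: k v) auto

lemma ty_below_lift: "ty_below m A \<Longrightarrow> m \<le> k \<Longrightarrow> lift_ty k A = A"
  by (induction A arbitrary: m k) auto

lemma ty_below_subst: "ty_below m A \<Longrightarrow> m \<le> k \<Longrightarrow> subst_ty k B A = A"
  by (induction A arbitrary: m k B) auto

lemma below_lift: "below m n t \<Longrightarrow> n \<le> k \<Longrightarrow> lift k t = t"
  by (induction t arbitrary: m n k) auto

lemma below_tylift: "below m n t \<Longrightarrow> m \<le> k \<Longrightarrow> tylift k t = t"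
  by (induction t arbitrary: m n k) (auto simp: ty_below_lift)

lemma below_subst: "below m n t \<Longrightarrow> n \<le> k \<Longrightarrow> subst k v t = t"
  by (induction t arbitrary: m n k v) auto

lemma below_tysubst: "below m n t \<Longrightarrow> m \<le> k \<Longrightarrow> tysubst k B t = t"
  by (induction t arbitrary: m n k B) (auto simp: ty_below_subst)

text \<open>The translation carries \<open>s\<close> under binders unlifted; this justifies
  it.\<close>

lemma closed_stable:
  assumes "closed s"
  shows "lift k s = s" "tylift k s = s" "subst k v s = s" "tysubst k B s = s"
  using assms unfolding closed_def
  by (rule below_lift below_tylift below_subst below_tysubst, simp)+


section \<open>Reduction is a congruence and stable under lifting\<close>

text \<open>\<open>bar_tm\<close> lifts its argument twice before translating it, so a source step
  has to survive lifting.\<close>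

lemma red_lift:
  "t \<rightarrow>\<^sub>t t' \<Longrightarrow> lift_tm k t \<rightarrow>\<^sub>t lift_tm k t'"
  "l \<rightarrow>\<^sub>l l' \<Longrightarrow> lift_co k l \<rightarrow>\<^sub>l lift_co k l'"
  "c \<rightarrow>\<^sub>c c' \<Longrightarrow> lift_cmd k c \<rightarrow>\<^sub>c lift_cmd k c'"
proof (induction arbitrary: k and k and k rule: red_tm_red_co_red_cmd.inducts)
  case (mu l)
  show ?case
    using red_tm_red_co_red_cmd.mu[of "lift_co k l"] by (simp add: lift_lift)
next
  case (beta t u l)
  show ?case
    using red_tm_red_co_red_cmd.beta[of "lift_tm (Suc k) t" "lift_tm k u" "lift_co k l"]
    by (simp add: lift_lift)
qed (auto intro: red_tm_red_co_red_cmd.intros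
      simp: lift_append lift_subst_above lift_tysubst)

lemma beta_red_lift: "t \<rightarrow>\<^sub>\<beta> t' \<Longrightarrow> lift k t \<rightarrow>\<^sub>\<beta> lift k t'"
  by (induction arbitrary: k rule: beta_red.induct)
    (auto intro: beta_red.intros simp: lift_subst_lam_above lift_tysubst_lam)

lemma beta_plus_map:
  assumes "t \<rightarrow>\<^sub>\<beta>\<^sup>+ t'" and "\<And>x y. x \<rightarrow>\<^sub>\<beta> y \<Longrightarrow> f x \<rightarrow>\<^sub>\<beta> f y"
  shows "f t \<rightarrow>\<^sub>\<beta>\<^sup>+ f t'"
  using assms(1)
  by (induction rule: tranclp_induct) (auto intro: assms(2) tranclp.intros)

lemma beta_plus_Abs: "t \<rightarrow>\<^sub>\<beta>\<^sup>+ t' \<Longrightarrow> Abs t \<rightarrow>\<^sub>\<beta>\<^sup>+ Abs t'"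
  and beta_plus_TAbs: "t \<rightarrow>\<^sub>\<beta>\<^sup>+ t' \<Longrightarrow> TAbs t \<rightarrow>\<^sub>\<beta>\<^sup>+ TAbs t'"
  and beta_plus_App1: "t \<rightarrow>\<^sub>\<beta>\<^sup>+ t' \<Longrightarrow> t \<cdot> u \<rightarrow>\<^sub>\<beta>\<^sup>+ t' \<cdot> u"
  and beta_plus_App2: "u \<rightarrow>\<^sub>\<beta>\<^sup>+ u' \<Longrightarrow> t \<cdot> u \<rightarrow>\<^sub>\<beta>\<^sup>+ t \<cdot> u'"
  and beta_plus_lift: "t \<rightarrow>\<^sub>\<beta>\<^sup>+ t' \<Longrightarrow> lift k t \<rightarrow>\<^sub>\<beta>\<^sup>+ lift k t'"
  by (erule beta_plus_map, (rule beta_red.intros beta_red_lift)?, assumption)+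

text \<open>\<open>pass\<close> and \<open>swap\<close> hide the nested liftings in the defining equations of the translation, which
  induction hypotheses about \<open>lift k\<close> would otherwise rewrite from the inside.\<close>

definition pass :: "lam \<Rightarrow> lam \<Rightarrow> lam" where
  "pass G K = Abs (V 0 \<cdot> lift 0 G \<cdot> lift 0 K)"

definition swap :: "lam \<Rightarrow> lam" where
  "swap u = Abs (Abs (V 1 \<cdot> lift 1 u))"

lemma tr_simps:
  "tr_tm b T s (Lam t) G K = discard (K \<cdot> swap (bar_tm b T s t)) G"
  "tr_co b T s Empty G K = pass G K"
  "tr_co b T s (u \<Colon> l) G K = pass G (cont_arg (tr_co b T s l G K) (bar_tm b T s u))"
  "tr_co b T s (B \<Colon>\<^sub>T l) G K = pass G (cont_tyarg (tr_co b T s l G K) (star_ty b T B))"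
  by (simp_all add: pass_def swap_def del: bar_tm.simps)

declare tr_tm.simps(2) [simp del] tr_co.simps(1-3) [simp del] bar_tm.simps [simp del]
declare tr_simps [simp]

abbreviation beta_star :: "lam \<Rightarrow> lam \<Rightarrow> bool" (infix "\<rightarrow>\<^sub>\<beta>\<^sup>*" 50) where
  "t \<rightarrow>\<^sub>\<beta>\<^sup>* u \<equiv> beta_red\<^sup>*\<^sup>* t u"

lemma beta_plus_discard1: "t \<rightarrow>\<^sub>\<beta>\<^sup>+ t' \<Longrightarrow> discard t u \<rightarrow>\<^sub>\<beta>\<^sup>+ discard t' u"
  and beta_plus_discard2: "u \<rightarrow>\<^sub>\<beta>\<^sup>+ u' \<Longrightarrow> discard t u \<rightarrow>\<^sub>\<beta>\<^sup>+ discard t u'"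
  and beta_plus_cont_arg1: "L \<rightarrow>\<^sub>\<beta>\<^sup>+ L' \<Longrightarrow> cont_arg L U \<rightarrow>\<^sub>\<beta>\<^sup>+ cont_arg L' U"
  and beta_plus_cont_arg2: "U \<rightarrow>\<^sub>\<beta>\<^sup>+ U' \<Longrightarrow> cont_arg L U \<rightarrow>\<^sub>\<beta>\<^sup>+ cont_arg L U'"
  and beta_plus_cont_tyarg: "L \<rightarrow>\<^sub>\<beta>\<^sup>+ L' \<Longrightarrow> cont_tyarg L A \<rightarrow>\<^sub>\<beta>\<^sup>+ cont_tyarg L' A"
  unfolding discard_def cont_arg_def cont_tyarg_def
  by (intro beta_plus_Abs beta_plus_App1 beta_plus_App2 beta_plus_lift; assumption)+

lemma beta_plus_pass1: "G \<rightarrow>\<^sub>\<beta>\<^sup>+ G' \<Longrightarrow> pass G K \<rightarrow>\<^sub>\<beta>\<^sup>+ pass G' K"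
  and beta_plus_pass2: "K \<rightarrow>\<^sub>\<beta>\<^sup>+ K' \<Longrightarrow> pass G K \<rightarrow>\<^sub>\<beta>\<^sup>+ pass G K'"
  and beta_plus_swap: "u \<rightarrow>\<^sub>\<beta>\<^sup>+ u' \<Longrightarrow> swap u \<rightarrow>\<^sub>\<beta>\<^sup>+ swap u'"
  unfolding pass_def swap_def
  by (intro beta_plus_Abs beta_plus_App1 beta_plus_App2 beta_plus_lift; assumption)+

lemmas beta_plus_congs = beta_plus_Abs beta_plus_TAbs beta_plus_App1 beta_plus_App2
  beta_plus_lift beta_plus_discard1 beta_plus_discard2
  beta_plus_cont_arg1 beta_plus_cont_arg2 beta_plus_cont_tyarg
  beta_plus_pass1 beta_plus_pass2 beta_plus_swap

text \<open>A many-step reduction is an equality or a nonempty reduction, so the nonempty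
  congruences, which already cover the composite constructors, suffice.\<close>

lemma beta_star_map:
  assumes "t \<rightarrow>\<^sub>\<beta>\<^sup>* t'" and "\<And>x y. x \<rightarrow>\<^sub>\<beta>\<^sup>+ y \<Longrightarrow> f x \<rightarrow>\<^sub>\<beta>\<^sup>+ f y"
  shows "f t \<rightarrow>\<^sub>\<beta>\<^sup>* f t'"
  using assms by (metis rtranclp.rtrancl_refl rtranclpD tranclp_into_rtranclp)

lemma beta_star_Abs: "t \<rightarrow>\<^sub>\<beta>\<^sup>* t' \<Longrightarrow> Abs t \<rightarrow>\<^sub>\<beta>\<^sup>* Abs t'"
  and beta_star_TAbs: "t \<rightarrow>\<^sub>\<beta>\<^sup>* t' \<Longrightarrow> TAbs t \<rightarrow>\<^sub>\<beta>\<^sup>* TAbs t'"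
  and beta_star_swap: "t \<rightarrow>\<^sub>\<beta>\<^sup>* t' \<Longrightarrow> swap t \<rightarrow>\<^sub>\<beta>\<^sup>* swap t'"
  and beta_star_cont_tyarg: "L \<rightarrow>\<^sub>\<beta>\<^sup>* L' \<Longrightarrow> cont_tyarg L A \<rightarrow>\<^sub>\<beta>\<^sup>* cont_tyarg L' A"
  by (erule beta_star_map, erule beta_plus_congs)+

lemma beta_star_map2:
  assumes "t \<rightarrow>\<^sub>\<beta>\<^sup>* t'" "u \<rightarrow>\<^sub>\<beta>\<^sup>* u'"
    and "\<And>x y z. x \<rightarrow>\<^sub>\<beta>\<^sup>+ y \<Longrightarrow> f x z \<rightarrow>\<^sub>\<beta>\<^sup>+ f y z"
    and "\<And>x y z. x \<rightarrow>\<^sub>\<beta>\<^sup>+ y \<Longrightarrow> f z x \<rightarrow>\<^sub>\<beta>\<^sup>+ f z y"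
  shows "f t u \<rightarrow>\<^sub>\<beta>\<^sup>* f t' u'"
  using beta_star_map[OF assms(1), of "\<lambda>x. f x u"] beta_star_map[OF assms(2), of "f t'"] assms(3,4)
  by (meson rtranclp_trans)

lemma beta_star_App: "t \<rightarrow>\<^sub>\<beta>\<^sup>* t' \<Longrightarrow> u \<rightarrow>\<^sub>\<beta>\<^sup>* u' \<Longrightarrow> t \<cdot> u \<rightarrow>\<^sub>\<beta>\<^sup>* t' \<cdot> u'"
  and beta_star_discard: "t \<rightarrow>\<^sub>\<beta>\<^sup>* t' \<Longrightarrow> u \<rightarrow>\<^sub>\<beta>\<^sup>* u' \<Longrightarrow> discard t u \<rightarrow>\<^sub>\<beta>\<^sup>* discard t' u'"
  and beta_star_cont_arg: "t \<rightarrow>\<^sub>\<beta>\<^sup>* t' \<Longrightarrow> u \<rightarrow>\<^sub>\<beta>\<^sup>* u' \<Longrightarrow> cont_arg t u \<rightarrow>\<^sub>\<beta>\<^sup>* cont_arg t' u'"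
  and beta_star_pass: "t \<rightarrow>\<^sub>\<beta>\<^sup>* t' \<Longrightarrow> u \<rightarrow>\<^sub>\<beta>\<^sup>* u' \<Longrightarrow> pass t u \<rightarrow>\<^sub>\<beta>\<^sup>* pass t' u'"
  by (erule (1) beta_star_map2, (erule beta_plus_congs)+)+

lemmas beta_star_congs = beta_star_Abs beta_star_TAbs beta_star_swap beta_star_cont_tyarg
  beta_star_App beta_star_discard beta_star_cont_arg beta_star_pass


section \<open>The translation commutes with lifting and type substitution\<close>

text \<open>The index of \<open>\<bottom>\<close> once a new type variable \<open>k\<close> is inserted into the context.\<close>

abbreviation shift :: "nat \<Rightarrow> nat \<Rightarrow> nat" where
  "shift k b \<equiv> (if b < k then b else Suc b)"

lemma lift_bar_star_ty:
  "lift_ty k (bar_ty b T A) = bar_ty (shift k b) (lift_ty k T) (lift_ty k A)"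
  "lift_ty k (star_ty b T A) = star_ty (shift k b) (lift_ty k T) (lift_ty k A)"
proof (induction b T A and b T A arbitrary: k and k rule: bar_ty_star_ty.induct)
  case (4 b T A)
  \<comment> \<open>The induction hypothesis speaks of \<open>bar_ty\<close>, which must therefore
    stay folded.\<close>
  then show ?case by (simp add: lift_lift_ty del: bar_ty.simps)
qed (auto simp: neg_def)

text \<open>The shifted \<open>b\<close> and the lifted \<open>T\<close> are \<bottom> and \<top> in
  the context that still contains \<open>k\<close>, so replacing \<open>k\<close> affects neither. A
  type variable is its own \<open>star_ty\<close>, hence the substituted type is
  \<open>star_ty b T B\<close>.\<close>

lemma subst_bar_star_ty:
  "subst_ty k (star_ty b T B) (bar_ty (shift k b) (lift_ty k T) A) = bar_ty b T (subst_ty k B A)"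
  "subst_ty k (star_ty b T B) (star_ty (shift k b) (lift_ty k T) A) = star_ty b T (subst_ty k B A)"
proof -
  \<comment> \<open>\<open>bar_ty\<close> unfolds to \<open>star_ty\<close>, so induction on
    \<open>A\<close> for the latter is enough.\<close>
  show "subst_ty k (star_ty b T B) (star_ty (shift k b) (lift_ty k T) A) =
      star_ty b T (subst_ty k B A)" for A
  proof (induction A arbitrary: k b T B)
    case (All A)
    have "subst_ty (Suc k) (star_ty (Suc b) (lift_ty 0 T) (lift_ty 0 B))
        (star_ty (shift (Suc k) (Suc b)) (lift_ty (Suc k) (lift_ty 0 T)) A) =
      star_ty (Suc b) (lift_ty 0 T) (subst_ty (Suc k) (lift_ty 0 B) A)"
      by (rule All.IH)
    then show ?case
      by (cases "b < k") (simp_all add: lift_lift_ty lift_bar_star_ty neg_def)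
  qed (auto simp: neg_def)
  then show "subst_ty k (star_ty b T B) (bar_ty (shift k b) (lift_ty k T) A) =
      bar_ty b T (subst_ty k B A)"
    by (simp add: neg_def)
qed

text \<open>The argument of \<open>swap\<close> already lies under the binder of x, whence the index
  \<open>Suc k\<close> in its case.\<close>

lemma lift_conts:
  "lift k (discard t u) = discard (lift k t) (lift k u)"
  "lift k (cont_arg L U) = cont_arg (lift k L) (lift k U)"
  "lift k (cont_tyarg L A) = cont_tyarg (lift k L) A"
  "lift k (pass G K) = pass (lift k G) (lift k K)"
  "lift k (swap u) = swap (lift (Suc k) u)"
  by (simp_all add: discard_def cont_arg_def cont_tyarg_def pass_def swap_def
    lift_lift_lam)

lemma tylift_conts:
  "tylift k (discard t u) = discard (tylift k t) (tylift k u)"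
  "tylift k (cont_arg L U) = cont_arg (tylift k L) (tylift k U)"
  "tylift k (cont_tyarg L A) = cont_tyarg (tylift k L) (lift_ty k A)"
  "tylift k (pass G K) = pass (tylift k G) (tylift k K)"
  "tylift k (swap u) = swap (tylift k u)"
  by (simp_all add: discard_def cont_arg_def cont_tyarg_def pass_def swap_def
    lift_tylift_lam)

lemma subst_conts:
  "subst k v (discard t u) = discard (subst k v t) (subst k v u)"
  "subst k v (cont_arg L U) = cont_arg (subst k v L) (subst k v U)"
  "subst k v (cont_tyarg L A) = cont_tyarg (subst k v L) A"
  "subst k v (pass G K) = pass (subst k v G) (subst k v K)"
  "subst k v (swap u) = swap (subst (Suc k) (lift 0 v) u)"
  by (simp_all add: discard_def cont_arg_def cont_tyarg_def pass_def swap_def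
    lift_subst_lam_below lift_lift_lam)

lemma tysubst_conts:
  "tysubst k B (discard t u) = discard (tysubst k B t) (tysubst k B u)"
  "tysubst k B (cont_arg L U) = cont_arg (tysubst k B L) (tysubst k B U)"
  "tysubst k B (cont_tyarg L A) = cont_tyarg (tysubst k B L) (subst_ty k B A)"
  "tysubst k B (pass G K) = pass (tysubst k B G) (tysubst k B K)"
  "tysubst k B (swap u) = swap (tysubst k B u)"
  by (simp_all add: discard_def cont_arg_def cont_tyarg_def pass_def swap_def
    lift_tysubst_lam)

lemma lift_tr:
  assumes s_closed: "closed s"
  shows "lift k (tr_tm b T s t G K) = tr_tm b T s (lift_tm k t) (lift k G) (lift k K)"
  "lift k (tr_co b T s l G K) = tr_co b T s (lift_co k l) (lift k G) (lift k K)"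
  "lift k (tr_cmd b T s c G K) = tr_cmd b T s (lift_cmd k c) (lift k G) (lift k K)"
  "lift k (bar_tm b T s t) = bar_tm b T s (lift_tm k t)"
  \<comment> \<open>\<open>s\<close> is an argument of the recursion, so its closedness must take
    part in the induction.\<close>
  using s_closed
proof (induction b T s t G K and b T s l G K and b T s c G K and b T s t
    arbitrary: k and k and k and k rule: tr_tm_tr_co_tr_cmd_bar_tm.induct)
  case (13 b T s t)
  then show ?case by (simp add: bar_tm.simps lift_lift)
qed (simp_all add: closed_stable lift_conts lift_lift_lam)

lemma tylift_tr:
  assumes s_closed: "closed s"
  shows "tylift k (tr_tm b T s t G K) =
    tr_tm (shift k b) (lift_ty k T) s (tylift_tm k t) (tylift k G) (tylift k K)"
  "tylift k (tr_co b T s l G K) =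
    tr_co (shift k b) (lift_ty k T) s (tylift_co k l) (tylift k G) (tylift k K)"
  "tylift k (tr_cmd b T s c G K) =
    tr_cmd (shift k b) (lift_ty k T) s (tylift_cmd k c) (tylift k G) (tylift k K)"
  "tylift k (bar_tm b T s t) = bar_tm (shift k b) (lift_ty k T) s (tylift_tm k t)"
  using s_closed
proof (induction b T s t G K and b T s l G K and b T s c G K and b T s t
    arbitrary: k and k and k and k rule: tr_tm_tr_co_tr_cmd_bar_tm.induct)
  case (13 b T s t)
  then show ?case by (simp add: bar_tm.simps lift_tylift)
qed (simp_all add: closed_stable tylift_conts lift_tylift_lam lift_bar_star_ty lift_lift_ty)

lemma tysubst_tr:
  assumes s_closed: "closed s"
  shows "tysubst k (star_ty b T B) (tr_tm (shift k b) (lift_ty k T) s t G K) =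
    tr_tm b T s (tysubst_tm k B t)
      (tysubst k (star_ty b T B) G) (tysubst k (star_ty b T B) K)"
  "tysubst k (star_ty b T B) (tr_co (shift k b) (lift_ty k T) s l G K) =
    tr_co b T s (tysubst_co k B l)
      (tysubst k (star_ty b T B) G) (tysubst k (star_ty b T B) K)"
  "tysubst k (star_ty b T B) (tr_cmd (shift k b) (lift_ty k T) s c G K) =
    tr_cmd b T s (tysubst_cmd k B c)
      (tysubst k (star_ty b T B) G) (tysubst k (star_ty b T B) K)"
  "tysubst k (star_ty b T B) (bar_tm (shift k b) (lift_ty k T) s t) =
    bar_tm b T s (tysubst_tm k B t)"
  using s_closed
\<comment> \<open>The parameters change under a type binder; inducting on the shifted forms keeps
  the equations linking them to some \<open>b\<close> and \<open>T\<close>.\<close>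
proof (induction "shift k b" "lift_ty k T" s t G K and "shift k b" "lift_ty k T" s l G K
    and "shift k b" "lift_ty k T" s c G K and "shift k b" "lift_ty k T" s t
    arbitrary: k b T B and k b T B and k b T B and k b T B
    rule: tr_tm_tr_co_tr_cmd_bar_tm.induct)
  case (3 s t G K)
  have "tysubst (Suc k) (star_ty (Suc b) (lift_ty 0 T) (lift_ty 0 B))
    (bar_tm (shift (Suc k) (Suc b)) (lift_ty (Suc k) (lift_ty 0 T)) s t) =
    bar_tm (Suc b) (lift_ty 0 T) s (tysubst_tm (Suc k) (lift_ty 0 B) t)"
    \<comment> \<open>The equations hold because shifting and lifting commute with entering the type
      binder.\<close>
    using 3(2) by (intro 3(1)) (auto simp: lift_lift_ty)
  then show ?case
    by (cases "b < k") (simp_all add: tysubst_conts lift_lift_ty lift_bar_star_ty)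
next
  case (13 s t)
  then show ?case by (simp add: bar_tm.simps lift_tysubst)
qed (simp_all add: closed_stable tysubst_conts lift_tysubst_lam subst_bar_star_ty)


section \<open>Monotonicity and substitution\<close>

text \<open>For statements that vary only \<open>G\<close> and \<open>K\<close>, on which
  \<open>bar_tm\<close> does not depend.\<close>

lemmas tr_induct = tr_tm_tr_co_tr_cmd_bar_tm.induct(1-3)[where S = "\<lambda>_ _ _ _. True"]

lemma tr_mono_K:
  "K \<rightarrow>\<^sub>\<beta>\<^sup>+ K' \<Longrightarrow> tr_tm b T s t G K \<rightarrow>\<^sub>\<beta>\<^sup>+ tr_tm b T s t G K'"
  "K \<rightarrow>\<^sub>\<beta>\<^sup>+ K' \<Longrightarrow> tr_co b T s l G K \<rightarrow>\<^sub>\<beta>\<^sup>+ tr_co b T s l G K'"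
  "K \<rightarrow>\<^sub>\<beta>\<^sup>+ K' \<Longrightarrow> tr_cmd b T s c G K \<rightarrow>\<^sub>\<beta>\<^sup>+ tr_cmd b T s c G K'"
  by (induction b T s t G K and b T s l G K and b T s c G K
      arbitrary: K' and K' and K' rule: tr_induct)
    (auto intro: beta_plus_congs)

lemma tr_mono_G:
  "G \<rightarrow>\<^sub>\<beta>\<^sup>+ G' \<Longrightarrow> tr_tm b T s t G K \<rightarrow>\<^sub>\<beta>\<^sup>+ tr_tm b T s t G' K"
  "G \<rightarrow>\<^sub>\<beta>\<^sup>+ G' \<Longrightarrow> tr_co b T s l G K \<rightarrow>\<^sub>\<beta>\<^sup>+ tr_co b T s l G' K"
  "G \<rightarrow>\<^sub>\<beta>\<^sup>+ G' \<Longrightarrow> tr_cmd b T s c G K \<rightarrow>\<^sub>\<beta>\<^sup>+ tr_cmd b T s c G' K"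
proof (induction b T s t G K and b T s l G K and b T s c G K
    arbitrary: G' and G' and G' rule: tr_induct)
  case (6 b T s u l G K)
  then show ?case
    by (simp, meson beta_plus_congs tranclp_trans)
next
  case (7 b T s B l G K)
  then show ?case
    by (simp, meson beta_plus_congs tranclp_trans)
next
  \<comment> \<open>\<open>G\<close> also occurs in the continuation; its reduction there is
    transported by monotonicity in \<open>K\<close>.\<close>
  case (10 b T s t u l G K)
  then show ?case
    by (simp, meson beta_plus_congs tr_mono_K(1) tranclp_trans)
next
  case (11 b T s t B l G K)
  then show ?case
    by (simp, meson beta_plus_congs tr_mono_K(1) tranclp_trans)
qed (auto intro: beta_plus_congs)

lemma tr_mono_star:
  assumes "G \<rightarrow>\<^sub>\<beta>\<^sup>* G'" "K \<rightarrow>\<^sub>\<beta>\<^sup>* K'"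
  shows "tr_tm b T s t G K \<rightarrow>\<^sub>\<beta>\<^sup>* tr_tm b T s t G' K'"
  by (rule beta_star_map2[OF assms]; erule tr_mono_G tr_mono_K)

lemma subst_lift_bar: "closed s \<Longrightarrow> subst k v (bar_tm b T s (lift_tm k t)) = bar_tm b T s t"
  by (metis lift_tr(4) subst_lift_lam)

text \<open>\<open>G\<^sub>0\<close> and \<open>K\<^sub>0\<close> only drive the induction: the continuation built on the left contains lifted
  subterms and differs from the one of the recursion, so the hypotheses are needed for all \<open>G\<close> and \<open>K\<close>.\<close>

lemma subst_tr_lift:
  fixes G\<^sub>0 K\<^sub>0 :: lam
  assumes s_closed: "closed s"
  shows "subst k v (tr_tm b T s (lift_tm k t) G K) = tr_tm b T s t (subst k v G) (subst k v K)"
  "subst k v (tr_co b T s (lift_co k l) G K) = tr_co b T s l (subst k v G) (subst k v K)"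
  "subst k v (tr_cmd b T s (lift_cmd k c) G K) = tr_cmd b T s c (subst k v G) (subst k v K)"
  using s_closed
  by (induction b T s t G\<^sub>0 K\<^sub>0 and b T s l G\<^sub>0 K\<^sub>0 and b T s c G\<^sub>0 K\<^sub>0
    arbitrary: k v G K and k v G K and k v G K rule: tr_induct)
   (simp_all add: closed_stable subst_conts lift_subst_lam_below subst_lift_bar)

lemma bar_app:
  assumes s_closed: "closed s"
  shows "bar_tm b T s t \<cdot> G \<cdot> K \<rightarrow>\<^sub>\<beta>\<^sup>+ tr_tm b T s t G K"
proof -
  let ?M = "tr_tm b T s (lift_tm 0 t) (lift 0 G) (V 0)"
  have "bar_tm b T s t \<cdot> G \<rightarrow>\<^sub>\<beta>
      Abs (subst 1 (lift 0 G) (tr_tm b T s (lift_tm 0 (lift_tm 0 t)) (V 1) (V 0)))"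
    using beta_tm[of "Abs _"] by (simp add: bar_tm.simps)
  \<comment> \<open>Of two liftings at 0, one can be read as a lifting at 1, which the substitution
    at 1 cancels.\<close>
  also have "\<dots> = Abs ?M"
    using subst_tr_lift(1)[OF s_closed, of 1 "lift 0 G" b T "lift_tm 0 t"] by (simp add: lift_lift)
  finally have "bar_tm b T s t \<cdot> G \<cdot> K \<rightarrow>\<^sub>\<beta> Abs ?M \<cdot> K"
    by (rule beta_App1)
  moreover have "Abs ?M \<cdot> K \<rightarrow>\<^sub>\<beta> tr_tm b T s t G K"
    using beta_tm[of ?M K] by (simp add: subst_tr_lift s_closed)
  ultimately show ?thesis by auto
qed

section \<open>Contraction of administrative redexes\<close>

lemma pass_app: "pass G K \<cdot> u \<rightarrow>\<^sub>\<beta> u \<cdot> G \<cdot> K"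
  using beta_tm[of "V 0 \<cdot> lift 0 G \<cdot> lift 0 K" u] by (simp add: pass_def)

lemma discard_red: "discard t u \<rightarrow>\<^sub>\<beta> t"
  using beta_tm[of "lift 0 t" u] by (simp add: discard_def)

lemma cont_arg_app: "cont_arg L U \<cdot> u \<rightarrow>\<^sub>\<beta> u \<cdot> L \<cdot> U"
  using beta_tm[of "V 0 \<cdot> lift 0 L \<cdot> lift 0 U" u] by (simp add: cont_arg_def)

lemma cont_tyarg_app: "cont_tyarg L A \<cdot> u \<rightarrow>\<^sub>\<beta> L \<cdot> (u \<cdot>\<^sub>T A)"
  using beta_tm[of "lift 0 L \<cdot> (V 0 \<cdot>\<^sub>T A)" u] by (simp add: cont_tyarg_def)
lemma pass_bar:
  assumes s_closed: "closed s"
  shows "pass G K \<cdot> bar_tm b T s t \<rightarrow>\<^sub>\<beta>\<^sup>+ tr_tm b T s t G K"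
  using pass_app bar_app[OF s_closed] by (rule tranclp_into_tranclp2)

text \<open>For \<open>Sel c\<close> both sides coincide by definition, so the reduction may be
  empty; every other co-term is translated to a \<open>pass\<close>.\<close>

lemma co_app:
  assumes s_closed: "closed s"
  shows "tr_co b T s l G K \<cdot> bar_tm b T s t \<rightarrow>\<^sub>\<beta>\<^sup>* tr_cmd b T s (t \<bullet> l) G K"
proof (cases l)
  case (Sel c)
  then show ?thesis by simp
qed (simp_all add: pass_bar[OF s_closed] tranclp_into_rtranclp)

text \<open>The value on \<open>Sel c\<close> is junk: only evaluation contexts matter.\<close>

fun kont :: "nat \<Rightarrow> ty \<Rightarrow> lam \<Rightarrow> coterm \<Rightarrow> lam \<Rightarrow> lam \<Rightarrow> lam" where
  "kont b T s Empty G K = K"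
| "kont b T s (u \<Colon> l) G K = cont_arg (tr_co b T s l G K) (bar_tm b T s u)"
| "kont b T s (B \<Colon>\<^sub>T l) G K = cont_tyarg (tr_co b T s l G K) (star_ty b T B)"
| "kont b T s (Sel c) G K = K"

lemma tr_ectx:
  assumes "is_ectx E"
  shows "tr_cmd b T s (t \<bullet> E) G K = tr_tm b T s t G (kont b T s E G K)"
    and "tr_co b T s E G K = pass G (kont b T s E G K)"
  using assms by (cases E; simp)+

lemma lift_kont:
  assumes s_closed: "closed s"
  shows "is_ectx E \<Longrightarrow> lift k (kont b T s E G K) = kont b T s (lift_co k E) (lift k G) (lift k K)"
  using s_closed by (cases E) (simp_all add: lift_conts lift_tr)

text \<open>The continuation ends up at the end of the co-term, exactly where appending puts
  \<open>E\<close>. The two claims need each other: for \<open>Sel\<close> the context enters a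
  command, under a binder.\<close>

lemma tr_append:
  assumes s_closed: "closed s" and "is_ectx E"
  shows "tr_co b T s l G (kont b T s E G K) = tr_co b T s (l @@ E) G K"
    and "tr_cmd b T s (t \<bullet> l) G (kont b T s E G K) = tr_cmd b T s (t \<bullet> (l @@ E)) G K"
  using assms
  by (induction l E arbitrary: t G K and t G K rule: append_co.induct)
    (simp_all add: tr_ectx lift_kont)

text \<open>Genuine reductions arise only at occurrences of the variable \<open>k\<close>; the
  remaining cases propagate them by congruence.\<close>

lemma subst_tr:
  assumes s_closed: "closed s" and s_red: "\<And>G. s \<cdot> G \<rightarrow>\<^sub>\<beta>\<^sup>+ G"
  shows "subst k (bar_tm b T s v) (tr_tm b T s t G K) \<rightarrow>\<^sub>\<beta>\<^sup>*
    tr_tm b T s (subst_tm k v t) (subst k (bar_tm b T s v) G) (subst k (bar_tm b T s v) K)"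
  "subst k (bar_tm b T s v) (tr_co b T s l G K) \<rightarrow>\<^sub>\<beta>\<^sup>*
    tr_co b T s (subst_co k v l) (subst k (bar_tm b T s v) G) (subst k (bar_tm b T s v) K)"
  "subst k (bar_tm b T s v) (tr_cmd b T s c G K) \<rightarrow>\<^sub>\<beta>\<^sup>*
    tr_cmd b T s (subst_cmd k v c) (subst k (bar_tm b T s v) G) (subst k (bar_tm b T s v) K)"
  "subst k (bar_tm b T s v) (bar_tm b T s t) \<rightarrow>\<^sub>\<beta>\<^sup>* bar_tm b T s (subst_tm k v t)"
  using s_closed s_red
proof (induction b T s t G K and b T s l G K and b T s c G K and b T s t
    arbitrary: k v and k v and k v and k v rule: tr_tm_tr_co_tr_cmd_bar_tm.induct)
  case (1 b T s i G K)
  show ?case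
  proof (cases "i = k")
    case True
    have "bar_tm b T s v \<cdot> (s \<cdot> subst k (bar_tm b T s v) G) \<cdot> subst k (bar_tm b T s v) K
      \<rightarrow>\<^sub>\<beta>\<^sup>+ tr_tm b T s v (s \<cdot> subst k (bar_tm b T s v) G) (subst k (bar_tm b T s v) K)"
      using 1 by (simp add: bar_app)
    \<comment> \<open>The clause for variables wraps \<open>G\<close> in \<open>s\<close>, while the
      target has plain \<open>G\<close>.\<close>
    also have "\<dots> \<rightarrow>\<^sub>\<beta>\<^sup>+
        tr_tm b T s v (subst k (bar_tm b T s v) G) (subst k (bar_tm b T s v) K)"
      using 1 by (simp add: tr_mono_G)
    finally show ?thesis using True 1 by (simp add: closed_stable)
  qed (use 1 in \<open>simp add: closed_stable\<close>)
next
  case (3 b T s t G K)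
  \<comment> \<open>Under the type binder the substituted term is the translation of the lifted
    \<open>v\<close> with the shifted parameters.\<close>
  from 3(1)[OF 3(2,3), of k "tylift_tm 0 v"] 3(2) show ?case
    by (simp add: subst_conts tylift_tr beta_star_congs)
next
  case (10 b T s t u l G K)
  let ?S = "subst k (bar_tm b T s v)"
  have "?S (tr_cmd b T s (t \<bullet> (u \<Colon> l)) G K) \<rightarrow>\<^sub>\<beta>\<^sup>* tr_tm b T s (subst_tm k v t) (?S G)
      (cont_arg (?S (tr_co b T s l G K)) (?S (bar_tm b T s u)))"
    using 10(3)[OF 10(4,5), of k v] by (simp add: subst_conts)
  \<comment> \<open>The continuation is reduced only after the substitution has reached
    \<open>t\<close>, by monotonicity.\<close>
  also have "\<dots> \<rightarrow>\<^sub>\<beta>\<^sup>* tr_cmd b T s (subst_cmd k v (t \<bullet> (u \<Colon> l))) (?S G) (?S K)"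
    using 10 by (simp add: tr_mono_star beta_star_congs)
  finally show ?case .
next
  case (11 b T s t B l G K)
  let ?S = "subst k (bar_tm b T s v)"
  have "?S (tr_cmd b T s (t \<bullet> (B \<Colon>\<^sub>T l)) G K) \<rightarrow>\<^sub>\<beta>\<^sup>* tr_tm b T s (subst_tm k v t) (?S G)
      (cont_tyarg (?S (tr_co b T s l G K)) (star_ty b T B))"
    using 11(2)[OF 11(3,4), of k v] by (simp add: subst_conts)
  also have "\<dots> \<rightarrow>\<^sub>\<beta>\<^sup>* tr_cmd b T s (subst_cmd k v (t \<bullet> (B \<Colon>\<^sub>T l))) (?S G) (?S K)"
    using 11 by (simp add: tr_mono_star beta_star_congs)
  finally show ?case .
next
  case (13 b T s t)
  from 13(1)[OF 13(2,3), of "Suc (Suc k)" "lift_tm 0 (lift_tm 0 v)"] 13(2) show ?case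
    by (simp add: bar_tm.simps[of b T s t] bar_tm.simps[of b T s "subst_tm k v t"]
        lift_tr lift_subst_below beta_star_congs)
qed (simp_all add: closed_stable subst_conts lift_tr lift_subst_lam_below beta_star_congs)


section \<open>Simulation of the reduction rules\<close>

text \<open>Contracting the binder of x makes the reduction strict; \<open>subst_tr\<close> does the
  rest.\<close>

lemma tr_sigma:
  assumes s_closed: "closed s" and s_red: "\<And>G. s \<cdot> G \<rightarrow>\<^sub>\<beta>\<^sup>+ G"
  shows "tr_cmd b T s (t \<bullet> Sel c) G K \<rightarrow>\<^sub>\<beta>\<^sup>+ tr_cmd b T s (subst_cmd 0 t c) G K"
proof -
  have "tr_cmd b T s (t \<bullet> Sel c) G K \<rightarrow>\<^sub>\<beta>\<^sup>+
      subst 0 (bar_tm b T s t) (tr_cmd b T s c (lift 0 G) (lift 0 K))"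
    by (simp add: beta_tm tranclp.r_into_trancl)
  also have "\<dots> \<rightarrow>\<^sub>\<beta>\<^sup>* tr_cmd b T s (subst_cmd 0 t c) G K"
    using subst_tr(3)[OF assms, of 0 b T t c "lift 0 G" "lift 0 K"] by simp
  finally show ?thesis .
qed

lemma tr_pi:
  assumes s_closed: "closed s" and s_red: "\<And>G. s \<cdot> G \<rightarrow>\<^sub>\<beta>\<^sup>+ G" and "is_ectx E"
  shows "tr_cmd b T s (Coerce (t \<bullet> l) \<bullet> E) G K \<rightarrow>\<^sub>\<beta>\<^sup>+ tr_cmd b T s (t \<bullet> (l @@ E)) G K"
proof -
  have "tr_cmd b T s (Coerce (t \<bullet> l) \<bullet> E) G K =
      tr_cmd b T s (t \<bullet> l) (s \<cdot> G) (kont b T s E G K)"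
    using assms(3) by (simp add: tr_ectx)
  also have "\<dots> \<rightarrow>\<^sub>\<beta>\<^sup>+ tr_cmd b T s (t \<bullet> l) G (kont b T s E G K)"
    by (rule tr_mono_G, rule s_red)
  also have "\<dots> = tr_cmd b T s (t \<bullet> (l @@ E)) G K"
    using s_closed assms(3) by (rule tr_append)
  finally show ?thesis .
qed

lemma tr_beta:
  assumes s_closed: "closed s"
  shows "tr_cmd b T s (Lam t \<bullet> (u \<Colon> l)) G K \<rightarrow>\<^sub>\<beta>\<^sup>+
    tr_cmd b T s (u \<bullet> Sel (t \<bullet> lift_co 0 l)) G K"
proof -
  let ?L = "tr_co b T s l G K" and ?u = "bar_tm b T s u" and ?t = "bar_tm b T s t"
  have "tr_cmd b T s (Lam t \<bullet> (u \<Colon> l)) G K \<rightarrow>\<^sub>\<beta>\<^sup>+ cont_arg ?L ?u \<cdot> swap ?t"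
    by (simp add: discard_red tranclp.r_into_trancl)
  also have "\<dots> \<rightarrow>\<^sub>\<beta> swap ?t \<cdot> ?L \<cdot> ?u"
    by (rule cont_arg_app)
  also have "\<dots> \<rightarrow>\<^sub>\<beta> Abs (lift 0 ?L \<cdot> ?t) \<cdot> ?u"
    using beta_App1[OF beta_tm[of "Abs (V 1 \<cdot> lift 1 ?t)" ?L], of ?u] by (simp add: swap_def)
  \<comment> \<open>\<open>lift 0 ?L\<close> translates \<open>lift_co 0 l\<close>, so
    \<open>co_app\<close> applies under the binder of x.\<close>
  also have "\<dots> \<rightarrow>\<^sub>\<beta>\<^sup>* tr_cmd b T s (u \<bullet> Sel (t \<bullet> lift_co 0 l)) G K"
    using beta_star_congs(1,5) co_app[OF s_closed, of b T "lift_co 0 l" "lift 0 G" "lift 0 K" t]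
    by (simp add: lift_tr[OF s_closed])
  finally show ?thesis .
qed

lemma tr_beta2:
  assumes s_closed: "closed s"
  shows "tr_cmd b T s (TLam t \<bullet> (B \<Colon>\<^sub>T l)) G K \<rightarrow>\<^sub>\<beta>\<^sup>+ tr_cmd b T s (tysubst_tm 0 B t \<bullet> l) G K"
proof -
  let ?L = "tr_co b T s l G K" and ?t = "bar_tm (Suc b) (lift_ty 0 T) s t"
  have "tr_cmd b T s (TLam t \<bullet> (B \<Colon>\<^sub>T l)) G K \<rightarrow>\<^sub>\<beta>\<^sup>+ cont_tyarg ?L (star_ty b T B) \<cdot> TAbs ?t"
    by (simp add: discard_red tranclp.r_into_trancl)
  also have "\<dots> \<rightarrow>\<^sub>\<beta> ?L \<cdot> (TAbs ?t \<cdot>\<^sub>T star_ty b T B)"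
    by (rule cont_tyarg_app)
  \<comment> \<open>\<open>tysubst_tr\<close> at index 0, where \<open>shift 0 b\<close> is
    \<open>Suc b\<close>.\<close>
  also have "\<dots> \<rightarrow>\<^sub>\<beta> ?L \<cdot> bar_tm b T s (tysubst_tm 0 B t)"
    using beta_App2[OF beta_ty[of ?t "star_ty b T B"], of ?L]
      tysubst_tr(4)[OF s_closed, of 0 b T B t] by simp
  also have "\<dots> \<rightarrow>\<^sub>\<beta>\<^sup>* tr_cmd b T s (tysubst_tm 0 B t \<bullet> l) G K"
    by (rule co_app[OF s_closed])
  finally show ?thesis .
qed

lemma tr_mu:
  assumes s_closed: "closed s" and s_red: "\<And>G. s \<cdot> G \<rightarrow>\<^sub>\<beta>\<^sup>+ G"
  shows "tr_co b T s (Sel (Var 0 \<bullet> lift_co 0 l)) G K \<rightarrow>\<^sub>\<beta>\<^sup>+ tr_co b T s l G K"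
proof (cases "is_ectx l")
  case True
  then have "tr_co b T s (Sel (Var 0 \<bullet> lift_co 0 l)) G K =
      Abs (V 0 \<cdot> (s \<cdot> lift 0 G) \<cdot> lift 0 (kont b T s l G K))"
    by (simp add: tr_ectx lift_kont[OF s_closed])
  also have "\<dots> \<rightarrow>\<^sub>\<beta>\<^sup>+ pass G (kont b T s l G K)"
    unfolding pass_def by (intro beta_plus_Abs beta_plus_App1 beta_plus_App2 s_red)
  finally show ?thesis
    using True by (simp add: tr_ectx)
next
  case False
  then obtain c where "l = Sel c" by (cases l) auto
  \<comment> \<open>The body is then also a \<sigma>-redex, whose contractum is \<open>c\<close> up
    to the renaming \<open>subst_Var_lift\<close>.\<close>
  then show ?thesis
    using tr_sigma[OF assms, of b T "Var 0" "lift_cmd 1 c" "lift 0 G" "lift 0 K"]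
    by (simp add: subst_Var_lift beta_plus_Abs)
qed

text \<open>Induction follows the translation and inverts the source step in each case, since the
  clauses for commands depend on the shape of the co-term.\<close>

lemma tr_red:
  assumes s_closed: "closed s" and s_red: "\<And>G. s \<cdot> G \<rightarrow>\<^sub>\<beta>\<^sup>+ G"
  shows "t \<rightarrow>\<^sub>t t' \<Longrightarrow> tr_tm b T s t G K \<rightarrow>\<^sub>\<beta>\<^sup>+ tr_tm b T s t' G K"
    and "l \<rightarrow>\<^sub>l l' \<Longrightarrow> tr_co b T s l G K \<rightarrow>\<^sub>\<beta>\<^sup>+ tr_co b T s l' G K"
    and "c \<rightarrow>\<^sub>c c' \<Longrightarrow> tr_cmd b T s c G K \<rightarrow>\<^sub>\<beta>\<^sup>+ tr_cmd b T s c' G K"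
    and "t \<rightarrow>\<^sub>t t' \<Longrightarrow> bar_tm b T s t \<rightarrow>\<^sub>\<beta>\<^sup>+ bar_tm b T s t'"
  using assms
proof (induction b T s t G K and b T s l G K and b T s c G K and b T s t
    arbitrary: t' and l' and c' and t' rule: tr_tm_tr_co_tr_cmd_bar_tm.induct)
  case (1 b T s x G K)
  from 1(1) show ?case by cases
next
  case (2 b T s t G K)
  from 2(2) show ?case
    by cases (simp add: 2 beta_plus_congs)
next
  case (3 b T s t G K)
  from 3(2) show ?case
    by cases (simp add: 3 beta_plus_congs)
next
  case (4 b T s c G K)
  from 4(2) show ?case
    \<comment> \<open>An \<epsilon>-step only turns \<open>s \<cdot> G\<close> into
      \<open>G\<close>.\<close>
    by cases (simp_all add: 4 tr_mono_G)
next
  case (5 b T s G K)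
  from 5(1) show ?case by cases
next
  case (6 b T s u l G K)
  from 6(3) show ?case
    by cases (simp_all add: 6 beta_plus_congs)
next
  case (7 b T s B l G K)
  from 7(2) show ?case
    by cases (simp_all add: 7 beta_plus_congs)
next
  case (8 b T s c G K)
  from 8(2) show ?case
  proof cases
    case mu
    then show ?thesis using tr_mu[OF 8(3,4)] by simp
  qed (simp add: 8 beta_plus_congs)
next
  case (9 b T s t G K)
  from 9(2) show ?case
  proof cases
    case (pi t l)
    then show ?thesis using tr_pi[OF 9(3,4), of Empty] by simp
  next
    case (red_Cmd2 l')
    \<comment> \<open>\<open>Empty\<close> has no reducts.\<close>
    from red_Cmd2(2) show ?thesis by cases
  qed (simp add: 9)
next
  case (10 b T s t u l G K)
  from 10(4) show ?case
  proof cases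
    case (beta t)
    then show ?thesis using tr_beta[OF 10(5)] by simp
  next
    case (pi t l')
    then show ?thesis using tr_pi[OF 10(5,6), of "u \<Colon> l"] by simp
  next
    case (red_Cmd2 l')
    \<comment> \<open>A step in \<open>u\<close> or \<open>l\<close> affects only the
      continuation.\<close>
    from red_Cmd2(2) show ?thesis
      by cases (simp_all add: red_Cmd2(1) 10 tr_mono_K beta_plus_congs)
  qed (simp add: 10)
next
  case (11 b T s t B l G K)
  from 11(3) show ?case
  proof cases
    case (beta2 t)
    then show ?thesis using tr_beta2[OF 11(4)] by simp
  next
    case (pi t l')
    then show ?thesis using tr_pi[OF 11(4,5), of "B \<Colon>\<^sub>T l"] by simp
  next
    case (red_Cmd2 l')
    from red_Cmd2(2) show ?thesis
      by cases (simp_all add: red_Cmd2(1) 11 tr_mono_K beta_plus_congs)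
  qed (simp add: 11)
next
  case (12 b T s t c G K)
  from 12(3) show ?case
  proof cases
    case sigma
    then show ?thesis using tr_sigma[OF 12(4,5)] by simp
  next
    case (pi t l)
    \<comment> \<open>\<open>Sel c\<close> is not an evaluation context, so \<pi> cannot
      apply.\<close>
    then show ?thesis by simp
  next
    case (red_Cmd1 t')
    then show ?thesis using 12(2)[OF _ 12(4,5)] by (simp add: beta_plus_congs)
  next
    case (red_Cmd2 l')
    from red_Cmd2(2) show ?thesis
    proof cases
      case mu
      \<comment> \<open>\<open>t (x)x l\<close> is also a \<open>\<sigma>\<close>-redex with the same contractum \<open>t l\<close>.\<close>
      then show ?thesis
        using tr_sigma[OF 12(4,5), of b T t c G K] by (simp add: red_Cmd2(1))
    next
      case (red_Sel c')
      then show ?thesis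
        using 12(1)[OF red_Cmd2(2) 12(4,5)] by (simp add: red_Cmd2(1) beta_plus_congs)
    qed
  qed
next
  case (13 b T s t)
  then show ?case by (simp add: bar_tm.simps red_lift beta_plus_congs)
qed

theorem theorem5p2:
  fixes b :: nat and T :: ty and s :: lam and t u :: tm
  assumes s_closed: "closed s"
    and s_red: "\<And>G. s \<cdot> G \<rightarrow>\<^sub>\<beta>\<^sup>+ G"
    and red: "t \<rightarrow>\<^sub>t u"
  shows "bar_tm b T s t \<rightarrow>\<^sub>\<beta>\<^sup>+ bar_tm b T s u"
  by (rule tr_red(4)[OF s_closed s_red red])

end
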